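(* Let $\mathcal I$ be an ideal on $\omega$. The map $$\mathfrak T\colon c_{0,\mathcal I}^*\longrightarrow \operatorname{ba}(\mathcal I),\qquad \Phi\longmapsto m_\Phi,$$ where $m_\Phi(A)=\Phi(\chi_A)$ for all $A\in\mathcal I$, is a surjective isometry.
   Context: $\mathbb K$ is the scalar field ($\mathbb R$ or $\mathbb C$). An ideal on $\omega$ is a collection of subsets of $\omega$ containing $\emptyset$, closed under subsets and finite unions; every ideal is assumed to contain all finite sets. $c_{0,\mathcal I}$ is the closed subspace of $\ell_\infty$ (over $\mathbb K$, with the sup norm) of all bounded sequences $(x_n)$ such that $\{n:|x_n|\ge\varepsilon\}\in\mathcal I$ for every $\varepsilon>0$. $\chi_A$ is the characteristic function of $A$. $\operatorname{ba}(\mathcal I)$ is the space of all $m\colon\mathcal I\to\mathbb K$ with $m(A\cup B)=m(A)+m(B)$ whenever $A,B\in\mathcal I$ are disjoint, and $\|m\|<\infty$, where $$\|m\|=\sup\Big\{\sum_{j=1}^n|m(A_j)| : n\in\mathbb N,\ A_1,\dots,A_n\in\mathcal I\text{ pairwise disjoint}\Big\};$$ it is a normed space with this norm. *)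

theory Defs
  imports "HOL-Analysis.Analysis"
begin

definition ideal_on_omega :: "nat set set \<Rightarrow> bool" where
  "ideal_on_omega I \<longleftrightarrow>
     {} \<in> I \<and>
     (\<forall>A B. A \<in> I \<and> B \<subseteq> A \<longrightarrow> B \<in> I) \<and>
     (\<forall>A B. A \<in> I \<and> B \<in> I \<longrightarrow> A \<union> B \<in> I) \<and>
     (\<forall>A. finite A \<longrightarrow> A \<in> I)"

text \<open>
  Since \<^typ>\<open>nat\<close> is discrete, \<open>nat \<Rightarrow>\<^sub>C 'k\<close> is the space of all bounded sequences with the
  supremum norm. The library makes it a real vector space only; multiplication by scalars from
  \<open>'k\<close> is added here. The scalar field is \<open>'k\<close>, to be instantiated by \<^typ>\<open>real\<close> or \<^typ>\<open>complex\<close>.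
\<close>

definition scale_seq :: "'k::real_normed_field \<Rightarrow> (nat \<Rightarrow>\<^sub>C 'k) \<Rightarrow> (nat \<Rightarrow>\<^sub>C 'k)" where
  "scale_seq c x = Bcontfun (\<lambda>n. c * apply_bcontfun x n)"

definition chi :: "nat set \<Rightarrow> (nat \<Rightarrow>\<^sub>C 'k::real_normed_field)" where
  "chi A = Bcontfun (indicator A)"

lemma apply_scale_seq [simp]:
  fixes c :: "'k::real_normed_field"
  shows "apply_bcontfun (scale_seq c x) n = c * apply_bcontfun x n"
proof -
  have "(\<lambda>n. c * apply_bcontfun x n) \<in> bcontfun"
  proof (rule bcontfun_normI)
    show "norm (c * apply_bcontfun x n) \<le> norm c * norm x" for n
      by (simp add: norm_mult mult_left_mono norm_bounded)
  qed simp
  then show ?thesis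
    by (simp add: scale_seq_def Bcontfun_inverse)
qed

lemma apply_chi [simp]:
  "apply_bcontfun (chi A :: nat \<Rightarrow>\<^sub>C 'k::real_normed_field) n = indicator A n"
proof -
  have "(indicator A :: nat \<Rightarrow> 'k) \<in> bcontfun"
    by (rule bcontfun_normI[where b = 1]) (simp_all add: indicator_def)
  then show ?thesis
    by (simp add: chi_def Bcontfun_inverse)
qed

definition c0 :: "nat set set \<Rightarrow> (nat \<Rightarrow>\<^sub>C 'k::real_normed_field) set" where
  "c0 I = {x. \<forall>\<epsilon>>0. {n. \<epsilon> \<le> norm (apply_bcontfun x n)} \<in> I}"

text \<open>
  Functionals on \<open>c0 I\<close> and set functions on \<open>I\<close> are represented by extensional functions, so that
  equality in HOL is equality on \<open>c0 I\<close> and on \<open>I\<close>, respectively.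
\<close>

definition dual_c0 :: "nat set set \<Rightarrow> ((nat \<Rightarrow>\<^sub>C 'k::real_normed_field) \<Rightarrow> 'k) set" where
  "dual_c0 I = {\<Phi> \<in> c0 I \<rightarrow>\<^sub>E UNIV.
     (\<forall>x\<in>c0 I. \<forall>y\<in>c0 I. \<Phi> (x + y) = \<Phi> x + \<Phi> y) \<and>
     (\<forall>c. \<forall>x\<in>c0 I. \<Phi> (scale_seq c x) = c * \<Phi> x) \<and>
     (\<exists>C. \<forall>x\<in>c0 I. norm (\<Phi> x) \<le> C * norm x)}"

definition norm_dual :: "nat set set \<Rightarrow> ((nat \<Rightarrow>\<^sub>C 'k::real_normed_field) \<Rightarrow> 'k) \<Rightarrow> real" where
  "norm_dual I \<Phi> = (SUP x \<in> {x \<in> c0 I. norm x \<le> 1}. norm (\<Phi> x))"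

definition variation_sums :: "nat set set \<Rightarrow> (nat set \<Rightarrow> 'k::real_normed_field) \<Rightarrow> real set" where
  "variation_sums I m =
     {(\<Sum>j=1..n. norm (m (A j))) | (n::nat) A. (\<forall>j\<in>{1..n}. A j \<in> I) \<and> disjoint_family_on A {1..n}}"

definition ba :: "nat set set \<Rightarrow> (nat set \<Rightarrow> 'k::real_normed_field) set" where
  "ba I = {m \<in> I \<rightarrow>\<^sub>E UNIV.
     (\<forall>A\<in>I. \<forall>B\<in>I. A \<inter> B = {} \<longrightarrow> m (A \<union> B) = m A + m B) \<and>
     bdd_above (variation_sums I m)}"

definition norm_ba :: "nat set set \<Rightarrow> (nat set \<Rightarrow> 'k::real_normed_field) \<Rightarrow> real" where
  "norm_ba I m = Sup (variation_sums I m)"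

definition T_map ::
    "nat set set \<Rightarrow> ((nat \<Rightarrow>\<^sub>C 'k::real_normed_field) \<Rightarrow> 'k) \<Rightarrow> (nat set \<Rightarrow> 'k)" where
  "T_map I \<Phi> = (\<lambda>A\<in>I. \<Phi> (chi A))"

text \<open>
  \<open>V\<close> and \<open>W\<close> are spaces of scalar functions on \<open>D\<close> and \<open>E\<close> with the pointwise operations, normed
  by \<open>nV\<close> and \<open>nW\<close>. As usual for normed spaces, an isometry is understood to be linear.
\<close>

definition surjective_isometry ::
    "'a set \<Rightarrow> ('a \<Rightarrow> 'k::real_normed_field) set \<Rightarrow> (('a \<Rightarrow> 'k) \<Rightarrow> real) \<Rightarrow>
     'b set \<Rightarrow> ('b \<Rightarrow> 'k) set \<Rightarrow> (('b \<Rightarrow> 'k) \<Rightarrow> real) \<Rightarrow>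
     (('a \<Rightarrow> 'k) \<Rightarrow> ('b \<Rightarrow> 'k)) \<Rightarrow> bool" where
  "surjective_isometry D V nV E W nW T \<longleftrightarrow>
     T ` V = W \<and>
     (\<forall>f\<in>V. \<forall>g\<in>V. T (\<lambda>x\<in>D. f x + g x) = (\<lambda>y\<in>E. T f y + T g y)) \<and>
     (\<forall>c. \<forall>f\<in>V. T (\<lambda>x\<in>D. c * f x) = (\<lambda>y\<in>E. c * T f y)) \<and>
     (\<forall>f\<in>V. \<forall>g\<in>V. nW (\<lambda>y\<in>E. T f y - T g y) = nV (\<lambda>x\<in>D. f x - g x))"

end

theory Submission
  imports Defs
begin

text \<open>
  A functional \<open>\<Phi>\<close> is recovered from \<open>m\<^sub>\<Phi>\<close> because the simple functions with support in \<open>I\<close> are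
  dense in \<open>c\<^sub>0\<^sub>,\<^sub>I\<close>. Conversely, integration of simple functions against \<open>m \<in> ba I\<close> is
  \<open>\<parallel>m\<parallel>\<close>-Lipschitz in the supremum norm and therefore extends to \<open>c\<^sub>0\<^sub>,\<^sub>I\<close>, which gives surjectivity
  and \<open>\<parallel>\<Phi>\<parallel> \<le> \<parallel>m\<^sub>\<Phi>\<parallel>\<close>. The reverse inequality is obtained by testing \<open>\<Phi>\<close> on \<open>\<Sum>\<^sub>j c\<^sub>j \<chi>\<^bsub>A\<^sub>j\<^esub>\<close>, where
  the \<open>A\<^sub>j\<close> are disjoint and \<open>\<bar>c\<^sub>j\<bar> \<le> 1\<close> is chosen such that \<open>c\<^sub>j m\<^sub>\<Phi>(A\<^sub>j) = \<bar>m\<^sub>\<Phi>(A\<^sub>j)\<bar>\<close>.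
\<close>

section \<open>Simple sequences and their integrals\<close>

definition simple_seq :: "nat set set \<Rightarrow> (nat \<Rightarrow> 'k::real_normed_field) \<Rightarrow> bool" where
  "simple_seq I s \<longleftrightarrow> finite (range s) \<and> {n. s n \<noteq> 0} \<in> I"

text \<open>
  The value \<open>m (s -` {0})\<close> is meaningless, as \<open>s -` {0}\<close> need not lie in \<open>I\<close>, but it is multiplied
  by \<open>0\<close>.
\<close>

definition simple_integral_ba :: "(nat set \<Rightarrow> 'k::real_normed_field) \<Rightarrow> (nat \<Rightarrow> 'k) \<Rightarrow> 'k" where
  "simple_integral_ba m s = (\<Sum>c\<in>range s. c * m (s -` {c}))"

text \<open>This characterises the value of the continuous extension at \<open>x\<close> by its
  distance to all simple integrals instead of by a chosen approximating sequence. Every property of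
  the integral then follows by testing on suitable \<open>s\<close>.\<close>

definition has_integral_ba ::
    "nat set set \<Rightarrow> (nat set \<Rightarrow> 'k::real_normed_field) \<Rightarrow> (nat \<Rightarrow> 'k) \<Rightarrow> 'k \<Rightarrow> bool" where
  "has_integral_ba I m x z \<longleftrightarrow>
     (\<forall>s c. simple_seq I s \<and> (\<forall>n. norm (x n - s n) \<le> c) \<longrightarrow>
       norm (z - simple_integral_ba m s) \<le> norm_ba I m * c)"

section \<open>Closure properties of ideals\<close>

lemma ideal_empty: "ideal_on_omega I \<Longrightarrow> {} \<in> I"
  and ideal_subset: "ideal_on_omega I \<Longrightarrow> A \<in> I \<Longrightarrow> B \<subseteq> A \<Longrightarrow> B \<in> I"
  and ideal_Un: "ideal_on_omega I \<Longrightarrow> A \<in> I \<Longrightarrow> B \<in> I \<Longrightarrow> A \<union> B \<in> I"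
  unfolding ideal_on_omega_def by blast+

lemma ideal_UN:
  assumes "ideal_on_omega I" "finite F" "\<And>d. d \<in> F \<Longrightarrow> A d \<in> I"
  shows "(\<Union>d\<in>F. A d) \<in> I"
  using assms(2,3)
  by (induction F rule: finite_induct) (auto simp: ideal_empty[OF assms(1)] ideal_Un[OF assms(1)])

subsection \<open>Finitely additive set functions\<close>

text \<open>The sums defining the variation are indexed by \<open>{1..n}\<close>. Enumerating
  \<open>F\<close> frees the index set, so that level sets can later be indexed by their
  values.\<close>

lemma variation_sum_le_norm_ba:
  assumes "m \<in> ba I" "finite F" "\<And>d. d \<in> F \<Longrightarrow> A d \<in> I" "disjoint_family_on A F"
  shows "(\<Sum>d\<in>F. norm (m (A d))) \<le> norm_ba I m"
proof -
  obtain h where h: "bij_betw h {1..card F} F"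
    using ex_bij_betw_nat_finite_1[OF assms(2)] by blast
  have "disjoint_family_on (A \<circ> h) {1..card F}"
    unfolding disjoint_family_on_def
  proof (intro ballI impI)
    fix i j assume ij: "i \<in> {1..card F}" "j \<in> {1..card F}" "i \<noteq> j"
    then have "h i \<noteq> h j"
      using inj_onD[OF bij_betw_imp_inj_on[OF h]] by blast
    then show "(A \<circ> h) i \<inter> (A \<circ> h) j = {}"
      using disjoint_family_onD[OF assms(4) bij_betwE[OF h, rule_format, OF ij(1)]
          bij_betwE[OF h, rule_format, OF ij(2)]] by simp
  qed
  moreover have "\<forall>j\<in>{1..card F}. (A \<circ> h) j \<in> I"
    using assms(3) bij_betwE[OF h] by simp
  ultimately have "(\<Sum>j=1..card F. norm (m ((A \<circ> h) j))) \<in> variation_sums I m"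
    unfolding variation_sums_def by (intro CollectI exI[of _ "card F"] exI[of _ "A \<circ> h"] conjI refl)
  moreover have "(\<Sum>d\<in>F. norm (m (A d))) = (\<Sum>j=1..card F. norm (m ((A \<circ> h) j)))"
    using sum.reindex_bij_betw[OF h, of "\<lambda>d. norm (m (A d))"] by simp
  ultimately show ?thesis
    using assms(1) unfolding ba_def norm_ba_def by (simp add: cSup_upper)
qed

lemma norm_ba_nonneg: "m \<in> ba I \<Longrightarrow> 0 \<le> norm_ba I m"
  using variation_sum_le_norm_ba[of m I "{}"] by (simp add: disjoint_family_on_def)

lemma ba_UN:
  assumes I: "ideal_on_omega I" and m: "m \<in> ba I"
    and "finite F" "\<And>d. d \<in> F \<Longrightarrow> A d \<in> I" "disjoint_family_on A F"
  shows "m (\<Union>d\<in>F. A d) = (\<Sum>d\<in>F. m (A d))"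
  using assms(3-5)
proof (induction F rule: finite_induct)
  case empty
  have "m ({} \<union> {}) = m {} + m {}"
    using m ideal_empty[OF I] unfolding ba_def by blast
  then show ?case by simp
next
  case (insert d F)
  have "(\<Union>d\<in>F. A d) \<in> I"
    using insert ideal_UN[OF I] by blast
  moreover have "A d \<inter> (\<Union>d\<in>F. A d) = {}"
    using insert.hyps insert.prems(2) unfolding disjoint_family_on_def by auto
  ultimately have "m (A d \<union> (\<Union>d\<in>F. A d)) = m (A d) + m (\<Union>d\<in>F. A d)"
    using m insert.prems(1) unfolding ba_def by blast
  moreover have "disjoint_family_on A F"
    using insert.prems(2) by (auto simp: disjoint_family_on_def)
  ultimately show ?case using insert by simp
qed

subsection \<open>The integral of simple functions\<close>

text \<open>The condition \<open>f 0 0 = 0\<close> keeps the support inside the union of the two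
  supports. Sums, differences and, with an \<open>f\<close> ignoring its second argument, scalar
  multiples are all instances.\<close>

lemma simple_seq_compose2:
  assumes "ideal_on_omega I" "simple_seq I s" "simple_seq I t" "f 0 0 = 0"
  shows "simple_seq I (\<lambda>n. f (s n) (t n))"
proof -
  have "range (\<lambda>n. f (s n) (t n)) \<subseteq> (\<lambda>(a, b). f a b) ` (range s \<times> range t)" by auto
  then have "finite (range (\<lambda>n. f (s n) (t n)))"
    using assms(2,3) finite_subset unfolding simple_seq_def by blast
  moreover have "{n. f (s n) (t n) \<noteq> 0} \<subseteq> {n. s n \<noteq> 0} \<union> {n. t n \<noteq> 0}"
    using assms(4) by auto
  then have "{n. f (s n) (t n) \<noteq> 0} \<in> I"
    using assms(2,3) unfolding simple_seq_def
    by - (rule ideal_subset[OF assms(1) ideal_Un[OF assms(1)]], auto)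
  ultimately show ?thesis by (simp add: simple_seq_def)
qed

lemma simple_seq_0: "ideal_on_omega I \<Longrightarrow> simple_seq I (\<lambda>_. 0)"
  by (simp add: simple_seq_def ideal_empty)

lemma simple_seq_indicator: "A \<in> I \<Longrightarrow> simple_seq I (indicator A :: nat \<Rightarrow> 'a::real_normed_field)"
proof -
  assume "A \<in> I"
  moreover have "finite (range (indicator A :: nat \<Rightarrow> 'a))"
    by (rule finite_subset[of _ "{0, 1}"]) (auto simp: indicator_def)
  ultimately show ?thesis by (simp add: simple_seq_def indicator_def)
qed

lemma simple_seq_vimage:
  "\<lbrakk>ideal_on_omega I; simple_seq I s; c \<noteq> 0\<rbrakk> \<Longrightarrow> s -` {c} \<in> I"
  unfolding simple_seq_def by (rule ideal_subset[of I "{n. s n \<noteq> 0}"]) auto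

text \<open>The level sets of \<open>h\<close> refine those of \<open>u\<close> composed with
  \<open>h\<close>, and finite additivity allows the integral to be computed on the finer partition.
  Since the values of \<open>h\<close> may have any type, one \<open>h\<close> can serve several
  simple sequences at once.\<close>

lemma simple_integral_ba_compose:
  assumes I: "ideal_on_omega I" and m: "m \<in> ba I"
    and h: "finite (range h)" and s: "simple_seq I (\<lambda>n. u (h n))"
  shows "simple_integral_ba m (\<lambda>n. u (h n)) = (\<Sum>d\<in>range h. u d * m (h -` {d}))"
proof -
  have "(\<Sum>d\<in>range h. u d * m (h -` {d})) =
      (\<Sum>c\<in>u ` range h. \<Sum>d\<in>{d\<in>range h. u d = c}. u d * m (h -` {d}))"
    using h by (rule sum.image_gen)
  also have "\<dots> = (\<Sum>c\<in>u ` range h. c * m ((\<lambda>n. u (h n)) -` {c}))"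
  proof (rule sum.cong[OF refl])
    fix c assume "c \<in> u ` range h"
    let ?F = "{d\<in>range h. u d = c}"
    show "(\<Sum>d\<in>?F. u d * m (h -` {d})) = c * m ((\<lambda>n. u (h n)) -` {c})"
    \<comment> \<open>Level sets of \<open>h\<close> inside a non-zero fibre lie in
      \<open>I\<close>, so additivity applies to them. Those inside the zero fibre may lie outside
      \<open>I\<close>, but there both sides have the factor 0.\<close>
    proof (cases "c = 0")
      case False
      have *: "(\<lambda>n. u (h n)) -` {c} = (\<Union>d\<in>?F. h -` {d})" by auto
      have "(\<Union>d\<in>?F. h -` {d}) \<in> I"
        using simple_seq_vimage[OF I s False] unfolding * .
      then have "h -` {d} \<in> I" if "d \<in> ?F" for d
        using that ideal_subset[OF I] by blast
      moreover have "disjoint_family_on (\<lambda>d. h -` {d}) ?F"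
        by (auto simp: disjoint_family_on_def)
      ultimately have "m (\<Union>d\<in>?F. h -` {d}) = (\<Sum>d\<in>?F. m (h -` {d}))"
        using h by (intro ba_UN[OF I m]) auto
      then show ?thesis unfolding * by (simp add: sum_distrib_left)
    qed (simp add: sum.neutral)
  qed
  finally show ?thesis
    unfolding simple_integral_ba_def by (simp add: image_image)
qed

lemma simple_integral_ba_add:
  assumes I: "ideal_on_omega I" and m: "m \<in> ba I" and s: "simple_seq I s" and t: "simple_seq I t"
  shows "simple_integral_ba m (\<lambda>n. s n + t n) = simple_integral_ba m s + simple_integral_ba m t"
proof -
  \<comment> \<open>The level sets of the pair are a common refinement for \<open>s\<close>,
    \<open>t\<close> and their sum, so all three integrals become sums over the same index
    set.\<close>
  define h where "h n = (s n, t n)" for n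
  have "finite (range h)"
    using s t unfolding simple_seq_def h_def
    by - (rule finite_subset[of _ "range s \<times> range t"], auto)
  note comp = simple_integral_ba_compose[OF I m this]
  have "simple_integral_ba m s = (\<Sum>d\<in>range h. fst d * m (h -` {d}))"
    "simple_integral_ba m t = (\<Sum>d\<in>range h. snd d * m (h -` {d}))"
    using comp[of fst] comp[of snd] s t by (simp_all add: h_def)
  moreover have "simple_integral_ba m (\<lambda>n. s n + t n) =
      (\<Sum>d\<in>range h. (fst d + snd d) * m (h -` {d}))"
    using comp[of "\<lambda>d. fst d + snd d"] simple_seq_compose2[OF I s t, of "(+)"] by (simp add: h_def)
  ultimately show ?thesis by (simp add: distrib_right sum.distrib)
qed

lemma simple_integral_ba_scale:
  assumes I: "ideal_on_omega I" and m: "m \<in> ba I" and s: "simple_seq I s"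
  shows "simple_integral_ba m (\<lambda>n. c * s n) = c * simple_integral_ba m s"
proof -
  have "simple_integral_ba m (\<lambda>n. c * s n) = (\<Sum>d\<in>range s. c * d * m (s -` {d}))"
    using s simple_integral_ba_compose[OF I m, of s "\<lambda>d. c * d"]
      simple_seq_compose2[OF I s s, of "\<lambda>a _. c * a"]
    by (simp add: simple_seq_def)
  then show ?thesis by (simp add: simple_integral_ba_def sum_distrib_left mult.assoc)
qed

lemma simple_integral_ba_0: "simple_integral_ba m (\<lambda>_. 0) = 0"
  by (simp add: simple_integral_ba_def)

lemma simple_integral_ba_indicator:
  assumes I: "ideal_on_omega I" and m: "m \<in> ba I" and A: "A \<in> I"
  shows "simple_integral_ba m (indicator A) = m A"
proof -
  have "m {} = 0"
    using ba_UN[OF I m, of "{}"] by (simp add: disjoint_family_on_def)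
  moreover have "range (indicator A :: nat \<Rightarrow> 'a) \<subseteq> {0, 1}"
    by (auto simp: indicator_def)
  \<comment> \<open>If \<open>A\<close> is empty or all of \<open>nat\<close>, one of the values 0
    and 1 is not attained. Its fibre is empty, so including it in the sum is harmless.\<close>
  then have "simple_integral_ba m (indicator A) =
      (\<Sum>c\<in>{0, 1}. c * m (indicator A -` {c}))"
    unfolding simple_integral_ba_def
  proof (rule sum.mono_neutral_left[rotated])
    show "\<forall>c\<in>{0, 1} - range (indicator A). c * m (indicator A -` {c}) = 0"
    proof
      fix c :: 'a assume "c \<in> {0, 1} - range (indicator A)"
      then have "indicator A -` {c} = {}" by auto
      then show "c * m (indicator A -` {c}) = 0" using \<open>m {} = 0\<close> by simp
    qed
  qed simp
  moreover have "indicator A -` {1::'a} = A"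
    by (auto simp: indicator_def)
  ultimately show ?thesis by simp
qed

text \<open>The non-zero fibres of \<open>s\<close> are disjoint members of \<open>I\<close>, and
  the coefficients have norm at most \<open>c\<close>; what remains is a variation sum of
  \<open>m\<close>.\<close>

lemma norm_simple_integral_ba_le:
  assumes I: "ideal_on_omega I" and m: "m \<in> ba I" and s: "simple_seq I s"
    and c: "\<And>n. norm (s n) \<le> c"
  shows "norm (simple_integral_ba m s) \<le> norm_ba I m * c"
proof -
  let ?F = "range s - {0}"
  have fin: "finite (range s)" using s by (simp add: simple_seq_def)
  have "0 \<le> c" using c[of 0] norm_ge_zero order_trans by blast
  have "simple_integral_ba m s = (\<Sum>d\<in>?F. d * m (s -` {d}))"
    unfolding simple_integral_ba_def by (rule sum.mono_neutral_right) (auto simp: fin)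
  also have "norm \<dots> \<le> (\<Sum>d\<in>?F. c * norm (m (s -` {d})))"
    using c by (intro sum_norm_le) (auto simp: norm_mult intro!: mult_right_mono)
  also have "\<dots> = c * (\<Sum>d\<in>?F. norm (m (s -` {d})))"
    by (simp add: sum_distrib_left)
  also have "\<dots> \<le> c * norm_ba I m"
    using \<open>0 \<le> c\<close> fin simple_seq_vimage[OF I s]
    by (intro mult_left_mono variation_sum_le_norm_ba[OF m]) (auto simp: disjoint_family_on_def)
  finally show ?thesis by (simp add: mult.commute)
qed

text \<open>This Lipschitz estimate is what lets the integral pass to uniform limits. Writing
  \<open>s\<close> as \<open>(s - t) + t\<close> reduces it to additivity and the previous
  bound.\<close>

lemma norm_simple_integral_ba_diff_le:
  assumes I: "ideal_on_omega I" and m: "m \<in> ba I" and s: "simple_seq I s" and t: "simple_seq I t"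
    and c: "\<And>n. norm (s n - t n) \<le> c"
  shows "norm (simple_integral_ba m s - simple_integral_ba m t) \<le> norm_ba I m * c"
proof -
  have d: "simple_seq I (\<lambda>n. s n - t n)"
    using simple_seq_compose2[OF I s t, of "(-)"] by simp
  have "simple_integral_ba m s = simple_integral_ba m (\<lambda>n. s n - t n) + simple_integral_ba m t"
    using simple_integral_ba_add[OF I m d t] by simp
  then show ?thesis
    using norm_simple_integral_ba_le[OF I m d c] by simp
qed

subsection \<open>The integral on \<open>c0 I\<close>\<close>

text \<open>The values of \<open>x\<close> lie in a compact ball, which has a finite \<epsilon>-net.
  Where \<open>norm (x n)\<close> is at least \<epsilon>, a nearby net point is taken; elsewhere 0
  is close enough. The support is then in \<open>I\<close> by the definition of
  \<open>c0\<close>.\<close>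

lemma c0_simple_approx:
  fixes x :: "nat \<Rightarrow>\<^sub>C 'k::{real_normed_field, heine_borel}"
  assumes I: "ideal_on_omega I" and x: "x \<in> c0 I" and "\<epsilon> > 0"
  obtains s where "simple_seq I s" "\<And>n. norm (x n - s n) \<le> \<epsilon>"
proof -
  have "compact (cball (0::'k) (norm x))" by (rule compact_cball)
  then obtain K where K: "finite K" "cball (0::'k) (norm x) \<subseteq> (\<Union>k\<in>K. ball k \<epsilon>)"
    using \<open>\<epsilon> > 0\<close> unfolding compact_eq_totally_bounded by blast
  have "\<exists>k\<in>K. dist k (x n) < \<epsilon>" for n
  proof -
    have "x n \<in> cball 0 (norm x)" unfolding mem_cball dist_0_norm by (rule norm_bounded)
    then have "x n \<in> (\<Union>k\<in>K. ball k \<epsilon>)" by (rule subsetD[OF K(2)])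
    then show ?thesis unfolding UN_iff mem_ball .
  qed
  then obtain k where k: "\<And>n. k n \<in> K" "\<And>n. dist (k n) (x n) < \<epsilon>" by metis
  define s where "s n = (if \<epsilon> \<le> norm (x n) then k n else 0)" for n
  have "finite (range s)"
    using K(1) k(1) by - (rule finite_subset[of _ "insert 0 K"], auto simp: s_def)
  moreover have "{n. s n \<noteq> 0} \<subseteq> {n. \<epsilon> \<le> norm (x n)}" by (auto simp: s_def)
  then have "{n. s n \<noteq> 0} \<in> I"
    using x \<open>\<epsilon> > 0\<close> unfolding c0_def by - (rule ideal_subset[OF I], auto)
  moreover have "norm (x n - s n) \<le> \<epsilon>" for n
    using k(2)[of n] by (auto simp: s_def dist_norm norm_minus_commute)
  ultimately show thesis using that by (simp add: simple_seq_def)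
qed

lemma has_integral_baD:
  "\<lbrakk>has_integral_ba I m x z; simple_seq I s; \<And>n. norm (x n - s n) \<le> c\<rbrakk>
    \<Longrightarrow> norm (z - simple_integral_ba m s) \<le> norm_ba I m * c"
  unfolding has_integral_ba_def by blast

lemma le_all_epsilon:
  fixes a b C :: real
  assumes "\<And>\<epsilon>. \<epsilon> > 0 \<Longrightarrow> a \<le> b + C * \<epsilon>"
  shows "a \<le> b"
proof (rule tendsto_lowerbound)
  show "((\<lambda>\<epsilon>. b + C * \<epsilon>) \<longlongrightarrow> b) (at_right 0)"
    by (auto intro!: tendsto_eq_intros)
  show "\<forall>\<^sub>F \<epsilon> in at_right 0. a \<le> b + C * \<epsilon>"
    using assms by (auto simp: eventually_at_filter)
qed simp

text \<open>Integrals of ever better simple approximations form a Cauchy sequence by the Lipschitz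
  estimate, and the scalar field is complete.\<close>

lemma ex_has_integral_ba:
  fixes x :: "nat \<Rightarrow>\<^sub>C 'k::{real_normed_field, heine_borel}"
  assumes I: "ideal_on_omega I" and m: "m \<in> ba I" and x: "x \<in> c0 I"
  shows "\<exists>z. has_integral_ba I m x z"
proof -
  define M where "M = norm_ba I m"
  have M: "0 \<le> M" using norm_ba_nonneg[OF m] by (simp add: M_def)
  have "\<exists>s. simple_seq I s \<and> (\<forall>n. norm (x n - s n) \<le> inverse (real (Suc k)))" for k
    by (rule c0_simple_approx[OF I x, of "inverse (real (Suc k))"]) auto
  then obtain s where s: "\<And>k. simple_seq I (s k)"
    and approx: "\<And>k n. norm (x n - s k n) \<le> inverse (real (Suc k))" by metis
  \<comment> \<open>Both \<open>s k\<close> and \<open>t\<close> are close to \<open>x\<close>,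
    hence to each other. With another member of the sequence as \<open>t\<close> this gives the
    Cauchy property; with \<open>t\<close> fixed and \<open>k\<close> tending to infinity it gives
    the estimate required of the limit.\<close>
  have near: "norm (simple_integral_ba m (s k) - simple_integral_ba m t)
      \<le> M * (inverse (real (Suc k)) + c)"
    if "simple_seq I t" "\<And>n. norm (x n - t n) \<le> c" for k t c
    unfolding M_def
  proof (rule norm_simple_integral_ba_diff_le[OF I m s that(1)])
    fix n
    have "norm (s k n - t n) \<le> norm (x n - s k n) + norm (x n - t n)"
      using norm_triangle_ineq4[of "x n - t n" "x n - s k n"] by (simp add: algebra_simps)
    then show "norm (s k n - t n) \<le> inverse (real (Suc k)) + c"
      using approx[where k = k and n = n] that(2)[of n] by linarith
  qed
  have "Cauchy (\<lambda>k. simple_integral_ba m (s k))"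
  proof (rule CauchyI)
    fix e :: real assume "0 < e"
    have "(\<lambda>k. M * (2 * inverse (real (Suc k)))) \<longlonglongrightarrow> M * (2 * 0)"
      by (intro tendsto_intros LIMSEQ_inverse_real_of_nat)
    then obtain N where N: "M * (2 * inverse (real (Suc N))) < e"
      using order_tendstoD(2)[of _ _ _ e] \<open>0 < e\<close> unfolding eventually_sequentially by fastforce
    show "\<exists>N. \<forall>j\<ge>N. \<forall>k\<ge>N. norm (simple_integral_ba m (s j) - simple_integral_ba m (s k)) < e"
    proof (intro exI[of _ N] allI impI)
      fix j k assume "N \<le> j" "N \<le> k"
      then have "inverse (real (Suc j)) + inverse (real (Suc k)) \<le> 2 * inverse (real (Suc N))"
        using le_imp_inverse_le[of "real (Suc N)" "real (Suc j)"]
          le_imp_inverse_le[of "real (Suc N)" "real (Suc k)"] by linarith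
      then have "M * (inverse (real (Suc j)) + inverse (real (Suc k)))
          \<le> M * (2 * inverse (real (Suc N)))"
        using M by (rule mult_left_mono)
      then show "norm (simple_integral_ba m (s j) - simple_integral_ba m (s k)) < e"
        using near[OF s approx, of j k] N by linarith
    qed
  qed
  then obtain z where z: "(\<lambda>k. simple_integral_ba m (s k)) \<longlonglongrightarrow> z"
    using Cauchy_convergent_iff convergent_def by blast
  have "norm (z - simple_integral_ba m t) \<le> M * c"
    if "simple_seq I t" "\<And>n. norm (x n - t n) \<le> c" for t c
  proof (rule LIMSEQ_le)
    show "(\<lambda>k. norm (simple_integral_ba m (s k) - simple_integral_ba m t))
        \<longlonglongrightarrow> norm (z - simple_integral_ba m t)"
      by (intro tendsto_intros z)
    have "(\<lambda>k. M * (inverse (real (Suc k)) + c)) \<longlonglongrightarrow> M * (0 + c)"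
      by (intro tendsto_intros LIMSEQ_inverse_real_of_nat)
    then show "(\<lambda>k. M * (inverse (real (Suc k)) + c)) \<longlonglongrightarrow> M * c" by simp
  qed (use near[OF that] in blast)
  then show ?thesis unfolding has_integral_ba_def M_def by blast
qed

lemma has_integral_ba_add:
  fixes x y :: "nat \<Rightarrow>\<^sub>C 'k::{real_normed_field, heine_borel}"
  assumes I: "ideal_on_omega I" and m: "m \<in> ba I" and x: "x \<in> c0 I" and y: "y \<in> c0 I"
    and z: "has_integral_ba I m x z" and w: "has_integral_ba I m y w"
    and v: "has_integral_ba I m (x + y) v"
  shows "v = z + w"
proof -
  \<comment> \<open>Both \<open>v\<close> and \<open>z + w\<close> are compared with the integral of
    \<open>s + t\<close>. The factor 4 is 2 for \<open>v\<close>, because \<open>s + t\<close> is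
    within \<open>2 * \<epsilon>\<close> of \<open>x + y\<close>, plus 1 each for \<open>z\<close>
    and \<open>w\<close>.\<close>
  have "norm (v - (z + w)) \<le> 0 + (4 * norm_ba I m) * \<epsilon>" if \<epsilon>: "\<epsilon> > 0" for \<epsilon>
  proof -
    obtain s where s: "simple_seq I s" "\<And>n. norm (x n - s n) \<le> \<epsilon>"
      using c0_simple_approx[OF I x \<epsilon>] by blast
    obtain t where t: "simple_seq I t" "\<And>n. norm (y n - t n) \<le> \<epsilon>"
      using c0_simple_approx[OF I y \<epsilon>] by blast
    have "norm ((x + y) n - (s n + t n)) \<le> 2 * \<epsilon>" for n
      using norm_diff_triangle_ineq[of "x n" "y n" "s n" "t n"] s(2)[of n] t(2)[of n]
      by (simp add: plus_bcontfun.rep_eq)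
    from has_integral_baD[OF v simple_seq_compose2[OF I s(1) t(1), of "(+)"] this]
    have "norm (v - (simple_integral_ba m s + simple_integral_ba m t)) \<le> norm_ba I m * (2 * \<epsilon>)"
      by (simp add: simple_integral_ba_add[OF I m s(1) t(1)])
    moreover have "norm (z + w - (simple_integral_ba m s + simple_integral_ba m t))
        \<le> norm_ba I m * \<epsilon> + norm_ba I m * \<epsilon>"
      using norm_diff_triangle_ineq[of z w "simple_integral_ba m s" "simple_integral_ba m t"]
        has_integral_baD[OF z s] has_integral_baD[OF w t] by linarith
    ultimately show ?thesis
      using norm_triangle_ineq4[of "v - (simple_integral_ba m s + simple_integral_ba m t)"
          "z + w - (simple_integral_ba m s + simple_integral_ba m t)"]
      by (simp add: algebra_simps)
  qed
  then have "norm (v - (z + w)) \<le> 0" by (rule le_all_epsilon)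
  then show ?thesis by simp
qed

lemma has_integral_ba_scale:
  fixes x :: "nat \<Rightarrow>\<^sub>C 'k::{real_normed_field, heine_borel}"
  assumes I: "ideal_on_omega I" and m: "m \<in> ba I" and x: "x \<in> c0 I"
    and z: "has_integral_ba I m x z" and v: "has_integral_ba I m (scale_seq c x) v"
  shows "v = c * z"
proof -
  \<comment> \<open>Both \<open>v\<close> and \<open>c * z\<close> differ from the integral of
    \<open>c * s\<close> by at most \<open>norm c * norm_ba I m * \<epsilon>\<close>.\<close>
  have "norm (v - c * z) \<le> 0 + (2 * norm c * norm_ba I m) * \<epsilon>" if \<epsilon>: "\<epsilon> > 0" for \<epsilon>
  proof -
    obtain s where s: "simple_seq I s" "\<And>n. norm (x n - s n) \<le> \<epsilon>"
      using c0_simple_approx[OF I x \<epsilon>] by blast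
    have "norm (scale_seq c x n - c * s n) \<le> norm c * \<epsilon>" for n
      using s(2)[of n] by (simp add: right_diff_distrib[symmetric] norm_mult mult_left_mono)
    moreover have "simple_seq I (\<lambda>n. c * s n)"
      using simple_seq_compose2[OF I s(1) s(1), of "\<lambda>a _. c * a"] by simp
    ultimately have "norm (v - c * simple_integral_ba m s) \<le> norm_ba I m * (norm c * \<epsilon>)"
      using has_integral_baD[OF v] simple_integral_ba_scale[OF I m s(1)] by metis
    moreover have "norm (c * z - c * simple_integral_ba m s) \<le> norm c * (norm_ba I m * \<epsilon>)"
      using has_integral_baD[OF z s]
      by (simp add: right_diff_distrib[symmetric] norm_mult mult_left_mono)
    ultimately show ?thesis
      using norm_triangle_ineq4[of "v - c * simple_integral_ba m s"
          "c * z - c * simple_integral_ba m s"]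
      by (simp add: algebra_simps)
  qed
  then have "norm (v - c * z) \<le> 0" by (rule le_all_epsilon)
  then show ?thesis by simp
qed

text \<open>The defining estimate is tested on the zero sequence, which is within
  \<open>norm x\<close> of \<open>x\<close>.\<close>

lemma norm_has_integral_ba_le:
  assumes I: "ideal_on_omega I" and z: "has_integral_ba I m (apply_bcontfun x) z"
  shows "norm z \<le> norm_ba I m * norm x"
  using has_integral_baD[OF z simple_seq_0[OF I], of "norm x"]
  by (simp add: norm_bounded simple_integral_ba_0)

text \<open>Since \<open>chi A\<close> is itself simple, the defining estimate applies with error
  0.\<close>

lemma has_integral_ba_chi:
  assumes I: "ideal_on_omega I" and m: "m \<in> ba I" and A: "A \<in> I"
    and z: "has_integral_ba I m (chi A) z"
  shows "z = m A"
  using has_integral_baD[OF z simple_seq_indicator[OF A], of 0]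
  by (simp add: simple_integral_ba_indicator[OF I m A])

subsection \<open>The space \<open>c0 I\<close> and its dual\<close>

lemma c0_add:
  assumes I: "ideal_on_omega I" and x: "x \<in> c0 I" and y: "y \<in> c0 I"
  shows "x + y \<in> c0 I"
  unfolding c0_def
proof (intro CollectI allI impI)
  fix \<epsilon> :: real assume "\<epsilon> > 0"
  have "{n. \<epsilon> \<le> norm ((x + y) n)} \<subseteq> {n. \<epsilon> / 2 \<le> norm (x n)} \<union> {n. \<epsilon> / 2 \<le> norm (y n)}"
  proof
    fix n assume "n \<in> {n. \<epsilon> \<le> norm ((x + y) n)}"
    then have "\<epsilon> \<le> norm (x n) + norm (y n)"
      using norm_triangle_ineq[of "x n" "y n"] by (simp add: plus_bcontfun.rep_eq)
    then show "n \<in> {n. \<epsilon> / 2 \<le> norm (x n)} \<union> {n. \<epsilon> / 2 \<le> norm (y n)}" by auto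
  qed
  moreover have "{n. \<epsilon> / 2 \<le> norm (x n)} \<in> I" "{n. \<epsilon> / 2 \<le> norm (y n)} \<in> I"
    using x y half_gt_zero[OF \<open>\<epsilon> > 0\<close>] unfolding c0_def by blast+
  ultimately show "{n. \<epsilon> \<le> norm ((x + y) n)} \<in> I"
    by (rule ideal_subset[OF I ideal_Un[OF I], rotated 2])
qed

lemma c0_scale:
  assumes I: "ideal_on_omega I" and x: "x \<in> c0 I"
  shows "scale_seq c x \<in> c0 I"
proof (cases "c = 0")
  case True
  then show ?thesis by (simp add: c0_def ideal_empty[OF I])
next
  case False
  show ?thesis
    unfolding c0_def
  proof (intro CollectI allI impI)
    fix \<epsilon> :: real assume "\<epsilon> > 0"
    have "{n. \<epsilon> \<le> norm (scale_seq c x n)} = {n. \<epsilon> / norm c \<le> norm (x n)}"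
      using False by (simp add: norm_mult field_simps)
    then show "{n. \<epsilon> \<le> norm (scale_seq c x n)} \<in> I"
      using x False \<open>\<epsilon> > 0\<close> by (simp add: c0_def)
  qed
qed

lemma c0_chi:
  assumes I: "ideal_on_omega I" and A: "A \<in> I"
  shows "chi A \<in> c0 I"
  unfolding c0_def
proof (intro CollectI allI impI)
  fix \<epsilon> :: real assume "\<epsilon> > 0"
  then have "{n. \<epsilon> \<le> norm (chi A n :: 'a)} \<subseteq> A"
    by (auto simp: indicator_def split: if_splits)
  then show "{n. \<epsilon> \<le> norm (chi A n :: 'a)} \<in> I"
    by (rule ideal_subset[OF I A])
qed

lemma c0_0: "ideal_on_omega I \<Longrightarrow> 0 \<in> c0 I"
  by (simp add: c0_def ideal_empty)

lemma c0_sum: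
  assumes "ideal_on_omega I" "finite F" "\<And>d. d \<in> F \<Longrightarrow> x d \<in> c0 I"
  shows "(\<Sum>d\<in>F. x d) \<in> c0 I"
  using assms(2,3)
  by (induction F rule: finite_induct) (simp_all add: c0_0[OF assms(1)] c0_add[OF assms(1)])

lemma apply_bcontfun_sum:
  "apply_bcontfun (\<Sum>d\<in>F. x d) n = (\<Sum>d\<in>F. apply_bcontfun (x d) n)"
  by (induction F rule: infinite_finite_induct) (simp_all add: plus_bcontfun.rep_eq)

lemma
  assumes "\<Phi> \<in> dual_c0 I"
  shows dual_c0_add: "\<lbrakk>x \<in> c0 I; y \<in> c0 I\<rbrakk> \<Longrightarrow> \<Phi> (x + y) = \<Phi> x + \<Phi> y"
    and dual_c0_scale: "x \<in> c0 I \<Longrightarrow> \<Phi> (scale_seq c x) = c * \<Phi> x"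
  using assms unfolding dual_c0_def by blast+

lemma dual_c0_sum:
  assumes I: "ideal_on_omega I" and \<Phi>: "\<Phi> \<in> dual_c0 I"
    and "finite F" "\<And>d. d \<in> F \<Longrightarrow> x d \<in> c0 I"
  shows "\<Phi> (\<Sum>d\<in>F. x d) = (\<Sum>d\<in>F. \<Phi> (x d))"
  using assms(3,4)
proof (induction F rule: finite_induct)
  case empty
  then show ?case using dual_c0_add[OF \<Phi>, of 0 0] c0_0[OF I] by simp
next
  case (insert d F)
  then show ?case using dual_c0_add[OF \<Phi>, of "x d" "sum x F"] c0_sum[OF I, of F x] by simp
qed

text \<open>The constant in \<open>dual_c0\<close> comes without a sign. A nonnegative one is
  provided so that inequalities can be multiplied by it.\<close>

lemma dual_c0_bounded:
  assumes "\<Phi> \<in> dual_c0 I"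
  obtains C where "0 \<le> C" "\<And>x. x \<in> c0 I \<Longrightarrow> norm (\<Phi> x) \<le> C * norm x"
proof -
  obtain C where C: "\<And>x. x \<in> c0 I \<Longrightarrow> norm (\<Phi> x) \<le> C * norm x"
    using assms unfolding dual_c0_def by blast
  have "norm (\<Phi> x) \<le> max C 0 * norm x" if "x \<in> c0 I" for x
    using C[OF that] mult_right_mono[of C "max C 0" "norm x"] by simp
  then show thesis using that[of "max C 0"] by simp
qed

lemma norm_le_norm_dual:
  assumes "\<Phi> \<in> dual_c0 I" "x \<in> c0 I" "norm x \<le> 1"
  shows "norm (\<Phi> x) \<le> norm_dual I \<Phi>"
proof -
  obtain C where C: "0 \<le> C" "\<And>x. x \<in> c0 I \<Longrightarrow> norm (\<Phi> x) \<le> C * norm x"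
    using dual_c0_bounded[OF assms(1)] by blast
  have "norm (\<Phi> y) \<le> C" if "y \<in> c0 I" "norm y \<le> 1" for y
    using C(2)[OF that(1)] mult_left_mono[OF that(2) C(1)] by simp
  then have "bdd_above ((\<lambda>x. norm (\<Phi> x)) ` {x \<in> c0 I. norm x \<le> 1})"
    by (intro bdd_aboveI[of _ C]) auto
  then show ?thesis
    unfolding norm_dual_def using assms(2,3) by (intro cSUP_upper) auto
qed

text \<open>The isometry condition concerns norms of differences; this makes the norm identity
  applicable to them.\<close>

lemma dual_c0_diff:
  assumes I: "ideal_on_omega I" and \<Phi>: "\<Phi> \<in> dual_c0 I" and \<Psi>: "\<Psi> \<in> dual_c0 I"
  shows "(\<lambda>x\<in>c0 I. \<Phi> x - \<Psi> x) \<in> dual_c0 I"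
proof -
  obtain C D where
    C: "\<And>x. x \<in> c0 I \<Longrightarrow> norm (\<Phi> x) \<le> C * norm x" and
    D: "\<And>x. x \<in> c0 I \<Longrightarrow> norm (\<Psi> x) \<le> D * norm x"
    using dual_c0_bounded[OF \<Phi>] dual_c0_bounded[OF \<Psi>] by metis
  have "norm (\<Phi> x - \<Psi> x) \<le> (C + D) * norm x" if "x \<in> c0 I" for x
    using norm_triangle_ineq4[of "\<Phi> x" "\<Psi> x"] C[OF that] D[OF that]
    by (simp add: distrib_right)
  then have "\<exists>E. \<forall>x\<in>c0 I. norm (\<Phi> x - \<Psi> x) \<le> E * norm x" by blast
  then show ?thesis
    unfolding dual_c0_def
    by (simp add: c0_add[OF I] c0_scale[OF I] dual_c0_add[OF \<Phi>] dual_c0_add[OF \<Psi>]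
        dual_c0_scale[OF \<Phi>] dual_c0_scale[OF \<Psi>] algebra_simps)
qed

lemma exists_norming_scalar:
  fixes z :: "'k::real_normed_field"
  obtains c where "norm c \<le> 1" "c * z = of_real (norm z)"
proof (cases "z = 0")
  case False
  then show thesis using that[of "of_real (norm z) / z"] by (simp add: norm_divide)
qed (use that[of 0] in simp)

subsection \<open>The isometry\<close>

lemma variation_sum_T_map_le:
  fixes \<Phi> :: "(nat \<Rightarrow>\<^sub>C 'k::real_normed_field) \<Rightarrow> 'k"
  assumes I: "ideal_on_omega I" and \<Phi>: "\<Phi> \<in> dual_c0 I" and "r \<in> variation_sums I (T_map I \<Phi>)"
  shows "r \<le> norm_dual I \<Phi>"
proof -
  obtain n and A :: "nat \<Rightarrow> nat set" where
    r: "r = (\<Sum>j=1..n. norm (T_map I \<Phi> (A j)))" and A: "\<And>j. j \<in> {1..n} \<Longrightarrow> A j \<in> I"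
    and disj: "disjoint_family_on A {1..n}"
    using assms(3) unfolding variation_sums_def by blast
  have "\<forall>j. \<exists>c. norm c \<le> 1 \<and> c * \<Phi> (chi (A j)) = of_real (norm (\<Phi> (chi (A j))))"
    using exists_norming_scalar by metis
  then obtain c where c: "\<And>j. norm (c j) \<le> 1"
    "\<And>j. c j * \<Phi> (chi (A j)) = of_real (norm (\<Phi> (chi (A j))))" by metis
  define x where "x = (\<Sum>j=1..n. scale_seq (c j) (chi (A j)))"
  have x: "x \<in> c0 I"
    unfolding x_def by (intro c0_sum c0_scale c0_chi I A) auto
  \<comment> \<open>By disjointness at most one summand is non-zero at \<open>k\<close>, so
    \<open>x k\<close> is either some \<open>c i\<close> or 0.\<close>
  have "norm (x k) \<le> 1" for k
  proof (cases "\<exists>i\<in>{1..n}. k \<in> A i")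
    case True
    then obtain i where i: "i \<in> {1..n}" "k \<in> A i" by blast
    then have "k \<notin> A j" if "j \<in> {1..n} - {i}" for j
      using disj that unfolding disjoint_family_on_def by blast
    then have "x k = c i"
      unfolding x_def apply_bcontfun_sum using i by (subst sum.remove[of _ i]) auto
    then show ?thesis using c(1) by simp
  next
    case False
    then have "x k = 0"
      unfolding x_def apply_bcontfun_sum by (intro sum.neutral) auto
    then show ?thesis by simp
  qed
  then have "norm x \<le> 1" by (rule norm_bound)
  have "\<Phi> x = (\<Sum>j=1..n. \<Phi> (scale_seq (c j) (chi (A j))))"
    unfolding x_def by (intro dual_c0_sum[OF I \<Phi>] c0_scale c0_chi I A) auto
  also have "\<dots> = (\<Sum>j=1..n. of_real (norm (\<Phi> (chi (A j)))))"
    by (intro sum.cong refl) (simp add: dual_c0_scale[OF \<Phi>] c0_chi[OF I A] c(2))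
  also have "\<dots> = of_real r"
    unfolding r T_map_def using A by simp
  finally have "norm (\<Phi> x) = \<bar>r\<bar>" by simp
  then show ?thesis
    using norm_le_norm_dual[OF \<Phi> x \<open>norm x \<le> 1\<close>] by simp
qed

lemma T_map_in_ba:
  assumes I: "ideal_on_omega I" and \<Phi>: "\<Phi> \<in> dual_c0 I"
  shows "T_map I \<Phi> \<in> ba I"
proof -
  have "T_map I \<Phi> (A \<union> B) = T_map I \<Phi> A + T_map I \<Phi> B"
    if "A \<in> I" "B \<in> I" "A \<inter> B = {}" for A B
  proof -
    have "chi (A \<union> B) = (chi A + chi B :: nat \<Rightarrow>\<^sub>C 'a)"
      using that(3) by (intro bcontfun_eqI) (auto simp: plus_bcontfun.rep_eq indicator_def)
    then show ?thesis
      using that by (simp add: T_map_def ideal_Un[OF I] dual_c0_add[OF \<Phi>] c0_chi[OF I])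
  qed
  moreover have "bdd_above (variation_sums I (T_map I \<Phi>))"
    using variation_sum_T_map_le[OF I \<Phi>] by (rule bdd_aboveI)
  ultimately show ?thesis by (simp add: ba_def T_map_def)
qed

text \<open>On simple sequences \<open>\<Phi>\<close> is integration against its own set function.
  The witness is the sum of \<open>c\<close> times the characteristic function of the fibre of
  \<open>c\<close>; the value 0 is left out because its fibre may lie outside
  \<open>I\<close>.\<close>

lemma dual_c0_simple:
  fixes \<Phi> :: "(nat \<Rightarrow>\<^sub>C 'k::real_normed_field) \<Rightarrow> 'k"
  assumes I: "ideal_on_omega I" and \<Phi>: "\<Phi> \<in> dual_c0 I" and s: "simple_seq I s"
  obtains y where "y \<in> c0 I" "\<And>n. apply_bcontfun y n = s n"
    "\<Phi> y = simple_integral_ba (T_map I \<Phi>) s"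
proof
  let ?F = "range s - {0}"
  define y where "y = (\<Sum>c\<in>?F. scale_seq c (chi (s -` {c})))"
  have fin: "finite (range s)" using s by (simp add: simple_seq_def)
  have chi: "chi (s -` {c}) \<in> c0 I" if "c \<in> ?F" for c
    using that simple_seq_vimage[OF I s] by (auto intro!: c0_chi[OF I])
  show "y \<in> c0 I"
    unfolding y_def using fin chi by (intro c0_sum c0_scale I) auto
  show "y n = s n" for n
  proof -
    \<comment> \<open>Only the fibre containing \<open>n\<close> contributes. If
      \<open>s n = 0\<close>, no summand does, and the empty contribution is the right
      value.\<close>
    have "y n = (\<Sum>c\<in>?F. if c = s n then c else 0)"
      unfolding y_def apply_bcontfun_sum by (intro sum.cong) (auto simp: indicator_def)
    then show ?thesis using fin by simp
  qed
  have "\<Phi> y = (\<Sum>c\<in>?F. \<Phi> (scale_seq c (chi (s -` {c}))))"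
    unfolding y_def using fin chi by (intro dual_c0_sum[OF I \<Phi>] c0_scale I) auto
  also have "\<dots> = (\<Sum>c\<in>?F. c * T_map I \<Phi> (s -` {c}))"
    using simple_seq_vimage[OF I s]
    by (intro sum.cong refl) (auto simp: T_map_def dual_c0_scale[OF \<Phi>] chi)
  also have "\<dots> = simple_integral_ba (T_map I \<Phi>) s"
    unfolding simple_integral_ba_def by (rule sum.mono_neutral_left) (auto simp: fin)
  finally show "\<Phi> y = simple_integral_ba (T_map I \<Phi>) s" .
qed

lemma norm_dual_c0_le_norm_ba:
  fixes \<Phi> :: "(nat \<Rightarrow>\<^sub>C 'k::{real_normed_field, heine_borel}) \<Rightarrow> 'k"
  assumes I: "ideal_on_omega I" and \<Phi>: "\<Phi> \<in> dual_c0 I" and x: "x \<in> c0 I"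
  shows "norm (\<Phi> x) \<le> norm_ba I (T_map I \<Phi>) * norm x"
proof -
  define M where "M = norm_ba I (T_map I \<Phi>)"
  obtain C where C: "0 \<le> C" "\<And>x. x \<in> c0 I \<Longrightarrow> norm (\<Phi> x) \<le> C * norm x"
    using dual_c0_bounded[OF \<Phi>] by blast
  \<comment> \<open>With \<open>y\<close> a simple approximation of \<open>x\<close>, the remainder
    \<open>x - y\<close> costs \<open>C * \<epsilon>\<close> by continuity, and \<open>y\<close>, of
    norm at most \<open>norm x + \<epsilon>\<close>, costs \<open>M * (norm x + \<epsilon>)\<close>.
    The unknown \<open>C\<close> disappears as \<epsilon> tends to 0.\<close>
  have "norm (\<Phi> x) \<le> M * norm x + (C + M) * \<epsilon>" if \<epsilon>: "\<epsilon> > 0" for \<epsilon>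
  proof -
    obtain s where s: "simple_seq I s" "\<And>n. norm (x n - s n) \<le> \<epsilon>"
      using c0_simple_approx[OF I x \<epsilon>] by blast
    obtain y where y: "y \<in> c0 I" "\<And>n. apply_bcontfun y n = s n"
      "\<Phi> y = simple_integral_ba (T_map I \<Phi>) s"
      using dual_c0_simple[OF I \<Phi> s(1)] by blast
    have "scale_seq (-1) y = - y"
      by (rule bcontfun_eqI) (simp add: uminus_bcontfun.rep_eq)
    then have diff: "x - y \<in> c0 I"
      using c0_add[OF I x c0_scale[OF I y(1), of "-1"]] by simp
    then have "\<Phi> x = \<Phi> (x - y) + \<Phi> y"
      using dual_c0_add[OF \<Phi> diff y(1)] by simp
    moreover have "norm (x - y) \<le> \<epsilon>"
      using s(2) y(2) by (intro norm_bound) (simp add: minus_bcontfun.rep_eq)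
    then have "norm (\<Phi> (x - y)) \<le> C * \<epsilon>"
      using C(2)[OF diff] mult_left_mono[OF _ C(1)] order_trans by blast
    moreover have "norm (s n) \<le> norm x + \<epsilon>" for n
      using s(2)[of n] norm_bounded[of x n] norm_triangle_ineq2[of "s n" "x n"]
      by (simp add: norm_minus_commute)
    then have "norm (\<Phi> y) \<le> M * (norm x + \<epsilon>)"
      unfolding M_def y(3) by (rule norm_simple_integral_ba_le[OF I T_map_in_ba[OF I \<Phi>] s(1)])
    ultimately show ?thesis
      using norm_triangle_ineq[of "\<Phi> (x - y)" "\<Phi> y"] by (simp add: algebra_simps)
  qed
  then show ?thesis unfolding M_def by (rule le_all_epsilon)
qed

lemma norm_ba_T_map:
  fixes \<Phi> :: "(nat \<Rightarrow>\<^sub>C 'k::{real_normed_field, heine_borel}) \<Rightarrow> 'k"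
  assumes I: "ideal_on_omega I" and \<Phi>: "\<Phi> \<in> dual_c0 I"
  shows "norm_ba I (T_map I \<Phi>) = norm_dual I \<Phi>"
proof (rule antisym)
  \<comment> \<open>Least-upper-bound arguments for real suprema need non-empty sets: the empty
    family is the witness here, the zero sequence in the second half.\<close>
  have "variation_sums I (T_map I \<Phi>) \<noteq> {}"
    unfolding variation_sums_def by (auto intro!: exI[of _ "0::nat"] simp: disjoint_family_on_def)
  then show "norm_ba I (T_map I \<Phi>) \<le> norm_dual I \<Phi>"
    unfolding norm_ba_def using variation_sum_T_map_le[OF I \<Phi>] by (rule cSup_least)
  show "norm_dual I \<Phi> \<le> norm_ba I (T_map I \<Phi>)"
    unfolding norm_dual_def
  proof (rule cSUP_least)
    show "{x \<in> c0 I. norm x \<le> 1} \<noteq> ({} :: (nat \<Rightarrow>\<^sub>C 'k) set)"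
      using c0_0[OF I] by (auto intro!: exI[of _ 0])
    fix x :: "nat \<Rightarrow>\<^sub>C 'k" assume x: "x \<in> {x \<in> c0 I. norm x \<le> 1}"
    then have "norm (\<Phi> x) \<le> norm_ba I (T_map I \<Phi>) * norm x"
      by (intro norm_dual_c0_le_norm_ba[OF I \<Phi>]) simp
    also have "\<dots> \<le> norm_ba I (T_map I \<Phi>)"
      using x norm_ba_nonneg[OF T_map_in_ba[OF I \<Phi>]] by (simp add: mult_left_le)
    finally show "norm (\<Phi> x) \<le> norm_ba I (T_map I \<Phi>)" .
  qed
qed

lemma T_map_surj:
  fixes m :: "nat set \<Rightarrow> 'k::{real_normed_field, heine_borel}"
  assumes I: "ideal_on_omega I" and m: "m \<in> ba I"
  obtains \<Phi> where "\<Phi> \<in> dual_c0 I" "T_map I \<Phi> = m"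
proof -
  \<comment> \<open>The functional is integration against \<open>m\<close>. The choice is justified
    on \<open>c0 I\<close> by the existence lemma, and the restriction makes \<open>\<Phi>\<close>
    extensional.\<close>
  define \<Phi> where "\<Phi> = (\<lambda>x\<in>c0 I. SOME z. has_integral_ba I m (apply_bcontfun x) z)"
  have \<Phi>: "has_integral_ba I m x (\<Phi> x)" if "x \<in> c0 I" for x
    unfolding \<Phi>_def using someI_ex[OF ex_has_integral_ba[OF I m that]] that by simp
  have "\<Phi> \<in> dual_c0 I"
    unfolding dual_c0_def
  proof (intro CollectI conjI ballI allI exI)
    show "\<Phi> \<in> c0 I \<rightarrow>\<^sub>E UNIV" by (simp add: \<Phi>_def)
    show "\<Phi> (x + y) = \<Phi> x + \<Phi> y" if "x \<in> c0 I" "y \<in> c0 I" for x y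
      by (rule has_integral_ba_add[OF I m that \<Phi> \<Phi> \<Phi>]) (simp_all add: that c0_add[OF I])
    show "\<Phi> (scale_seq c x) = c * \<Phi> x" if "x \<in> c0 I" for c x
      by (rule has_integral_ba_scale[OF I m that \<Phi> \<Phi>]) (simp_all add: that c0_scale[OF I])
    show "norm (\<Phi> x) \<le> norm_ba I m * norm x" if "x \<in> c0 I" for x
      by (rule norm_has_integral_ba_le[OF I \<Phi>[OF that]])
  qed
  moreover have "T_map I \<Phi> = m"
  proof
    fix A
    show "T_map I \<Phi> A = m A"
    proof (cases "A \<in> I")
      case True
      then show ?thesis
        using has_integral_ba_chi[OF I m True \<Phi>[OF c0_chi[OF I True]]] by (simp add: T_map_def)
    next
      \<comment> \<open>Outside \<open>I\<close> both set functions are extensional and hence equal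
        to \<open>undefined\<close>.\<close>
      case False
      then show ?thesis
        using PiE_arb[of m I "\<lambda>_. UNIV" A] m by (simp add: T_map_def ba_def)
    qed
  qed
  ultimately show thesis by (rule that)
qed

text \<open>Compactness of closed balls and completeness are the analytic facts used about the
  scalars, so the real and complex cases share one proof. Linearity holds because
  \<open>T_map\<close> evaluates at the elements \<open>chi A\<close> of \<open>c0 I\<close>, and it
  reduces the isometry clause to the norm identity for the difference.\<close>

lemma surjective_isometry_T_map:
  assumes I: "ideal_on_omega I"
  shows "surjective_isometry (c0 I) (dual_c0 I) (norm_dual I) I (ba I) (norm_ba I)
    (T_map I :: ((nat \<Rightarrow>\<^sub>C 'k::{real_normed_field, heine_borel}) \<Rightarrow> 'k) \<Rightarrow> nat set \<Rightarrow> 'k)"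
  unfolding surjective_isometry_def
proof (intro conjI ballI allI)
  show "T_map I ` dual_c0 I = (ba I :: (nat set \<Rightarrow> 'k) set)"
  proof (intro equalityI subsetI)
    fix m :: "nat set \<Rightarrow> 'k" assume "m \<in> ba I"
    then show "m \<in> T_map I ` dual_c0 I" by (metis T_map_surj[OF I] imageI)
  qed (use T_map_in_ba[OF I] in blast)
next
  fix \<Phi> \<Psi> :: "(nat \<Rightarrow>\<^sub>C 'k) \<Rightarrow> 'k" and c :: 'k
  note restrict = T_map_def c0_chi[OF I] fun_eq_iff
  show "T_map I (\<lambda>x\<in>c0 I. \<Phi> x + \<Psi> x) = (\<lambda>A\<in>I. T_map I \<Phi> A + T_map I \<Psi> A)"
    by (simp add: restrict)
  show "T_map I (\<lambda>x\<in>c0 I. c * \<Phi> x) = (\<lambda>A\<in>I. c * T_map I \<Phi> A)"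
    by (simp add: restrict)
  assume "\<Phi> \<in> dual_c0 I" "\<Psi> \<in> dual_c0 I"
  moreover have "(\<lambda>A\<in>I. T_map I \<Phi> A - T_map I \<Psi> A) = T_map I (\<lambda>x\<in>c0 I. \<Phi> x - \<Psi> x)"
    by (simp add: restrict)
  ultimately show "norm_ba I (\<lambda>A\<in>I. T_map I \<Phi> A - T_map I \<Psi> A) =
      norm_dual I (\<lambda>x\<in>c0 I. \<Phi> x - \<Psi> x)"
    by (simp add: norm_ba_T_map[OF I] dual_c0_diff[OF I])
qed

theorem theorem3p2:
  fixes I :: "nat set set"
  assumes "ideal_on_omega I"
  shows "surjective_isometry
           (c0 I) (dual_c0 I) (norm_dual I) I (ba I) (norm_ba I)
           (T_map I :: ((nat \<Rightarrow>\<^sub>C real) \<Rightarrow> real) \<Rightarrow> nat set \<Rightarrow> real) \<and>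
         surjective_isometry
           (c0 I) (dual_c0 I) (norm_dual I) I (ba I) (norm_ba I)
           (T_map I :: ((nat \<Rightarrow>\<^sub>C complex) \<Rightarrow> complex) \<Rightarrow> nat set \<Rightarrow> complex)"
  by (intro conjI surjective_isometry_T_map assms)

end
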